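(* Let $M$ be a non-zero left $R$-module which is an S-IAD-module. Then $\mathrm{Spec}^{\mathrm{fc}}(M)=\mathcal{S}(M)$ if and only if the topological space $\mathbf{Z}^{\mathrm{fc}}(M)$ is $T_1$.
   Context: $R$ is an associative (not necessarily commutative) ring with $1_R\neq 0_R$ and modules are unital left $R$-modules; $L\leq_R M$ means that $L$ is an $R$-submodule of $M$. A submodule $L\leq_R M$ is fully invariant if $f(L)\subseteq L$ for every $R$-linear endomorphism $f$ of $M$; $M$ is duo if every $R$-submodule of $M$ is fully invariant. $M$ is self-injective if for every $N\leq_R M$ every $R$-linear map $N\to M$ extends to an endomorphism of $M$. $M$ is atomic if every non-zero submodule of $M$ contains a simple submodule. An S-IAD-module is a module that is self-injective, atomic and duo. $\mathcal{S}(M)$ is the set of simple submodules of $M$. For $X,Y\leq_R M$ put $\mathrm{An}(X)=\{f\in \mathrm{End}_R(M)\mid f(X)=0\}$ and $X\odot_M Y=\bigcap_{f\in\mathrm{An}(X)} f^{-1}(Y)$. A non-zero fully invariant submodule $K$ of $M$ is fully coprime in $M$ if for all fully invariant submodules $X,Y$ of $M$: $K\subseteq X\odot_M Y$ implies $K\subseteq X$ or $K\subseteq Y$. $\mathrm{Spec}^{\mathrm{fc}}(M)$ is the set of all non-zero fully invariant submodules of $M$ that are fully coprime in $M$. For $M$ duo, $\mathbf{Z}^{\mathrm{fc}}(M)$ is $\mathrm{Spec}^{\mathrm{fc}}(M)$ with the topology whose closed sets are $\mathcal{V}^{\mathrm{fc}}(L)=\{K\in\mathrm{Spec}^{\mathrm{fc}}(M)\mid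 K\subseteq L\}$, $L\leq_R M$. *)

theory Defs
  imports "HOL-Algebra.Module" "HOL-Analysis.T1_Spaces"
begin

(* The library locale for modules assumes a commutative base ring; this is the same
   list of axioms over an arbitrary ring. The ring fields of the record M other than
   carrier, zero and addition play no role. *)
locale left_module = R?: ring R + M?: abelian_group M for R (structure) and M (structure) +
  assumes smult_closed [simp, intro]:
      "\<lbrakk>a \<in> carrier R; x \<in> carrier M\<rbrakk> \<Longrightarrow> a \<odot>\<^bsub>M\<^esub> x \<in> carrier M"
    and smult_l_distr:
      "\<lbrakk>a \<in> carrier R; b \<in> carrier R; x \<in> carrier M\<rbrakk> \<Longrightarrow>
        (a \<oplus>\<^bsub>R\<^esub> b) \<odot>\<^bsub>M\<^esub> x = a \<odot>\<^bsub>M\<^esub> x \<oplus>\<^bsub>M\<^esub> b \<odot>\<^bsub>M\<^esub> x"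
    and smult_r_distr:
      "\<lbrakk>a \<in> carrier R; x \<in> carrier M; y \<in> carrier M\<rbrakk> \<Longrightarrow>
        a \<odot>\<^bsub>M\<^esub> (x \<oplus>\<^bsub>M\<^esub> y) = a \<odot>\<^bsub>M\<^esub> x \<oplus>\<^bsub>M\<^esub> a \<odot>\<^bsub>M\<^esub> y"
    and smult_assoc1:
      "\<lbrakk>a \<in> carrier R; b \<in> carrier R; x \<in> carrier M\<rbrakk> \<Longrightarrow>
        (a \<otimes>\<^bsub>R\<^esub> b) \<odot>\<^bsub>M\<^esub> x = a \<odot>\<^bsub>M\<^esub> (b \<odot>\<^bsub>M\<^esub> x)"
    and smult_one [simp]:
      "x \<in> carrier M \<Longrightarrow> \<one>\<^bsub>R\<^esub> \<odot>\<^bsub>M\<^esub> x = x"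

(* As for the library's hom, values outside the carrier of N are unconstrained. *)
definition module_hom ::
  "('a, 'r) ring_scheme \<Rightarrow> ('a, 'b, 'n) module_scheme \<Rightarrow> ('a, 'c, 'm) module_scheme \<Rightarrow> ('b \<Rightarrow> 'c) set"
  where "module_hom R N M =
    {f \<in> hom (add_monoid N) (add_monoid M).
      \<forall>a \<in> carrier R. \<forall>x \<in> carrier N. f (a \<odot>\<^bsub>N\<^esub> x) = a \<odot>\<^bsub>M\<^esub> f x}"

definition module_End ::
  "('a, 'r) ring_scheme \<Rightarrow> ('a, 'b, 'm) module_scheme \<Rightarrow> ('b \<Rightarrow> 'b) set"
  where "module_End R M = module_hom R M M"

definition fully_invariant ::
  "('a, 'r) ring_scheme \<Rightarrow> ('a, 'b, 'm) module_scheme \<Rightarrow> 'b set \<Rightarrow> bool"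
  where "fully_invariant R M L \<longleftrightarrow>
    submodule L R M \<and> (\<forall>f \<in> module_End R M. f ` L \<subseteq> L)"

definition duo_module :: "('a, 'r) ring_scheme \<Rightarrow> ('a, 'b, 'm) module_scheme \<Rightarrow> bool"
  where "duo_module R M \<longleftrightarrow> (\<forall>L. submodule L R M \<longrightarrow> fully_invariant R M L)"

definition self_injective :: "('a, 'r) ring_scheme \<Rightarrow> ('a, 'b, 'm) module_scheme \<Rightarrow> bool"
  where "self_injective R M \<longleftrightarrow>
    (\<forall>N. submodule N R M \<longrightarrow>
      (\<forall>g \<in> module_hom R (M\<lparr>carrier := N\<rparr>) M. \<exists>f \<in> module_End R M. \<forall>x \<in> N. f x = g x))"

definition simple_submodules ::
  "('a, 'r) ring_scheme \<Rightarrow> ('a, 'b, 'm) module_scheme \<Rightarrow> 'b set set"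
  where "simple_submodules R M =
    {S. submodule S R M \<and> S \<noteq> {\<zero>\<^bsub>M\<^esub>} \<and>
      (\<forall>L. submodule L R M \<and> L \<subseteq> S \<longrightarrow> L = {\<zero>\<^bsub>M\<^esub>} \<or> L = S)}"

definition atomic_module :: "('a, 'r) ring_scheme \<Rightarrow> ('a, 'b, 'm) module_scheme \<Rightarrow> bool"
  where "atomic_module R M \<longleftrightarrow>
    (\<forall>L. submodule L R M \<and> L \<noteq> {\<zero>\<^bsub>M\<^esub>} \<longrightarrow> (\<exists>S \<in> simple_submodules R M. S \<subseteq> L))"

definition S_IAD_module :: "('a, 'r) ring_scheme \<Rightarrow> ('a, 'b, 'm) module_scheme \<Rightarrow> bool"
  where "S_IAD_module R M \<longleftrightarrow> self_injective R M \<and> atomic_module R M \<and> duo_module R M"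

definition An ::
  "('a, 'r) ring_scheme \<Rightarrow> ('a, 'b, 'm) module_scheme \<Rightarrow> 'b set \<Rightarrow> ('b \<Rightarrow> 'b) set"
  where "An R M X = {f \<in> module_End R M. \<forall>x \<in> X. f x = \<zero>\<^bsub>M\<^esub>}"

(* The operation X \<odot>_M Y of the source. *)
definition coproduct_in ::
  "('a, 'r) ring_scheme \<Rightarrow> ('a, 'b, 'm) module_scheme \<Rightarrow> 'b set \<Rightarrow> 'b set \<Rightarrow> 'b set"
  where "coproduct_in R M X Y = (\<Inter>f \<in> An R M X. {x \<in> carrier M. f x \<in> Y})"

definition fully_coprime ::
  "('a, 'r) ring_scheme \<Rightarrow> ('a, 'b, 'm) module_scheme \<Rightarrow> 'b set \<Rightarrow> bool"
  where "fully_coprime R M K \<longleftrightarrow>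
    fully_invariant R M K \<and> K \<noteq> {\<zero>\<^bsub>M\<^esub>} \<and>
    (\<forall>X Y. fully_invariant R M X \<and> fully_invariant R M Y \<and> K \<subseteq> coproduct_in R M X Y
       \<longrightarrow> K \<subseteq> X \<or> K \<subseteq> Y)"

definition Spec_fc :: "('a, 'r) ring_scheme \<Rightarrow> ('a, 'b, 'm) module_scheme \<Rightarrow> 'b set set"
  where "Spec_fc R M = {K. fully_coprime R M K}"

definition V_fc ::
  "('a, 'r) ring_scheme \<Rightarrow> ('a, 'b, 'm) module_scheme \<Rightarrow> 'b set \<Rightarrow> 'b set set"
  where "V_fc R M L = {K \<in> Spec_fc R M. K \<subseteq> L}"

(* The complements of the sets V_fc L form a topology when M is duo: see istopology_Z_fc
   and closedin_Z_fc below. For other M the definition is not meaningful. *)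
definition Z_fc :: "('a, 'r) ring_scheme \<Rightarrow> ('a, 'b, 'm) module_scheme \<Rightarrow> 'b set topology"
  where "Z_fc R M =
    topology (\<lambda>U. \<exists>L. submodule L R M \<and> U = Spec_fc R M - V_fc R M L)"

context left_module
begin

lemma submoduleD:
  assumes "submodule L R M"
  shows "L \<subseteq> carrier M" "\<zero>\<^bsub>M\<^esub> \<in> L"
    "\<And>x. x \<in> L \<Longrightarrow> \<ominus>\<^bsub>M\<^esub> x \<in> L"
    "\<And>x y. x \<in> L \<Longrightarrow> y \<in> L \<Longrightarrow> x \<oplus>\<^bsub>M\<^esub> y \<in> L"
    "\<And>a x. a \<in> carrier R \<Longrightarrow> x \<in> L \<Longrightarrow> a \<odot>\<^bsub>M\<^esub> x \<in> L"
  using group.subgroupE[of "add_monoid M" L, OF _ submodule.axioms(1)[OF assms]] a_comm_group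
    submodule.smult_closed[OF assms] subgroup.one_closed[OF submodule.axioms(1)[OF assms]]
  unfolding comm_group_def a_inv_def by auto

lemma submodule_intro:
  assumes "L \<subseteq> carrier M" "\<zero>\<^bsub>M\<^esub> \<in> L"
    and "\<And>x. x \<in> L \<Longrightarrow> \<ominus>\<^bsub>M\<^esub> x \<in> L"
    and "\<And>x y. x \<in> L \<Longrightarrow> y \<in> L \<Longrightarrow> x \<oplus>\<^bsub>M\<^esub> y \<in> L"
    and "\<And>a x. a \<in> carrier R \<Longrightarrow> x \<in> L \<Longrightarrow> a \<odot>\<^bsub>M\<^esub> x \<in> L"
  shows "submodule L R M"
  by (intro submodule.intro subgroup.intro submodule_axioms.intro)
    (use assms in \<open>auto simp: a_inv_def\<close>)

lemma submodule_carrier: "submodule (carrier M) R M"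
  by (rule submodule_intro) auto

lemma smult_zero: "a \<in> carrier R \<Longrightarrow> a \<odot>\<^bsub>M\<^esub> \<zero>\<^bsub>M\<^esub> = \<zero>\<^bsub>M\<^esub>"
  by (metis M.add.l_cancel_one' M.l_zero M.zero_closed smult_closed smult_r_distr)

lemma submodule_zero: "submodule {\<zero>\<^bsub>M\<^esub>} R M"
  by (rule submodule_intro) (auto simp: smult_zero)

lemma submodule_Inter:
  assumes "\<L> \<noteq> {}" "\<And>L. L \<in> \<L> \<Longrightarrow> submodule L R M"
  shows "submodule (\<Inter>\<L>) R M"
proof (rule submodule_intro)
  show "\<Inter>\<L> \<subseteq> carrier M"
    using assms submoduleD(1) by fast
qed (use submoduleD(2-5)[OF assms(2)] in auto)

lemma module_EndD:
  assumes "f \<in> module_End R M"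
  shows "\<And>x. x \<in> carrier M \<Longrightarrow> f x \<in> carrier M"
    "\<And>x y. x \<in> carrier M \<Longrightarrow> y \<in> carrier M \<Longrightarrow> f (x \<oplus>\<^bsub>M\<^esub> y) = f x \<oplus>\<^bsub>M\<^esub> f y"
    "\<And>a x. a \<in> carrier R \<Longrightarrow> x \<in> carrier M \<Longrightarrow> f (a \<odot>\<^bsub>M\<^esub> x) = a \<odot>\<^bsub>M\<^esub> f x"
    "f \<zero>\<^bsub>M\<^esub> = \<zero>\<^bsub>M\<^esub>"
    "\<And>x. x \<in> carrier M \<Longrightarrow> f (\<ominus>\<^bsub>M\<^esub> x) = \<ominus>\<^bsub>M\<^esub> f x"
proof -
  show cl: "f x \<in> carrier M" if "x \<in> carrier M" for x
    using assms that by (auto simp: module_End_def module_hom_def hom_def)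
  show add: "f (x \<oplus>\<^bsub>M\<^esub> y) = f x \<oplus>\<^bsub>M\<^esub> f y" if "x \<in> carrier M" "y \<in> carrier M" for x y
    using assms that by (auto simp: module_End_def module_hom_def hom_def)
  show "f (a \<odot>\<^bsub>M\<^esub> x) = a \<odot>\<^bsub>M\<^esub> f x" if "a \<in> carrier R" "x \<in> carrier M" for a x
    using assms that by (auto simp: module_End_def module_hom_def)
  show z: "f \<zero>\<^bsub>M\<^esub> = \<zero>\<^bsub>M\<^esub>"
    by (metis M.add.l_cancel_one' M.l_zero M.zero_closed cl add)
  show "f (\<ominus>\<^bsub>M\<^esub> x) = \<ominus>\<^bsub>M\<^esub> f x" if "x \<in> carrier M" for x
  proof -
    have "f (\<ominus>\<^bsub>M\<^esub> x) \<oplus>\<^bsub>M\<^esub> f x = \<zero>\<^bsub>M\<^esub>"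
      using add[of "\<ominus>\<^bsub>M\<^esub> x" x] that z by (simp add: M.l_neg)
    then show ?thesis
      using M.minus_equality that cl by auto
  qed
qed

lemma submodule_vimage:
  assumes "f \<in> module_End R M" "submodule Y R M"
  shows "submodule {x \<in> carrier M. f x \<in> Y} R M"
  by (rule submodule_intro)
    (use module_EndD[OF assms(1)] submoduleD[OF assms(2)] in auto)

lemma zero_in_An:
  assumes "X \<subseteq> carrier M"
  shows "(\<lambda>_. \<zero>\<^bsub>M\<^esub>) \<in> An R M X"
  by (auto simp: An_def module_End_def module_hom_def hom_def smult_zero)

lemma submodule_coproduct_in:
  assumes "submodule X R M" "submodule Y R M"
  shows "submodule (coproduct_in R M X Y) R M"
  unfolding coproduct_in_def
proof (rule submodule_Inter)
  show "(\<lambda>f. {x \<in> carrier M. f x \<in> Y}) ` An R M X \<noteq> {}"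
    using zero_in_An submoduleD(1)[OF assms(1)] by blast
  show "submodule L R M" if "L \<in> (\<lambda>f. {x \<in> carrier M. f x \<in> Y}) ` An R M X" for L
    using that submodule_vimage[OF _ assms(2)] by (auto simp: An_def)
qed

lemma V_fc_Un:
  assumes "duo_module R M" "submodule X R M" "submodule Y R M"
  shows "V_fc R M X \<union> V_fc R M Y = V_fc R M (coproduct_in R M X Y)"
proof -
  have fi: "fully_invariant R M X" "fully_invariant R M Y"
    using assms by (auto simp: duo_module_def)
  have "X \<subseteq> coproduct_in R M X Y"
    using submoduleD(1)[OF assms(2)] submoduleD(2)[OF assms(3)]
    by (auto simp: coproduct_in_def An_def)
  moreover have "Y \<subseteq> coproduct_in R M X Y"
    using submoduleD(1)[OF assms(3)] fi(2)
    by (auto simp: coproduct_in_def An_def fully_invariant_def)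
  moreover have "K \<subseteq> X \<or> K \<subseteq> Y"
    if "K \<in> Spec_fc R M" "K \<subseteq> coproduct_in R M X Y" for K
    using that fi unfolding Spec_fc_def fully_coprime_def by blast
  ultimately show ?thesis
    unfolding V_fc_def by blast
qed

lemma istopology_Z_fc:
  assumes "duo_module R M"
  shows "istopology (\<lambda>U. \<exists>L. submodule L R M \<and> U = Spec_fc R M - V_fc R M L)"
  unfolding istopology_def
proof (intro conjI allI impI)
  fix S T
  assume "\<exists>L. submodule L R M \<and> S = Spec_fc R M - V_fc R M L"
    and "\<exists>L. submodule L R M \<and> T = Spec_fc R M - V_fc R M L"
  then obtain X Y where X: "submodule X R M" "S = Spec_fc R M - V_fc R M X"
    and Y: "submodule Y R M" "T = Spec_fc R M - V_fc R M Y" by blast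
  have "S \<inter> T = Spec_fc R M - V_fc R M (coproduct_in R M X Y)"
    unfolding X(2) Y(2) V_fc_Un[OF assms X(1) Y(1), symmetric] by (rule Diff_Un [symmetric])
  with submodule_coproduct_in[OF X(1) Y(1)]
  show "\<exists>L. submodule L R M \<and> S \<inter> T = Spec_fc R M - V_fc R M L"
    by (intro exI conjI)
next
  fix \<K>
  assume *: "\<forall>K\<in>\<K>. \<exists>L. submodule L R M \<and> K = Spec_fc R M - V_fc R M L"
  show "\<exists>L. submodule L R M \<and> \<Union>\<K> = Spec_fc R M - V_fc R M L"
  proof (cases "\<K> = {}")
    case True
    have "V_fc R M (carrier M) = Spec_fc R M"
      using submoduleD(1)
      by (auto simp: V_fc_def Spec_fc_def fully_coprime_def fully_invariant_def)
    with True show ?thesis using submodule_carrier by auto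
  next
    case False
    from * obtain g where g: "\<And>K. K \<in> \<K> \<Longrightarrow> submodule (g K) R M"
      "\<And>K. K \<in> \<K> \<Longrightarrow> K = Spec_fc R M - V_fc R M (g K)"
      using bchoice[OF *] by fast
    have "submodule (\<Inter>(g ` \<K>)) R M"
      using False g(1) by (intro submodule_Inter) auto
    moreover have "\<Union>\<K> = Spec_fc R M - V_fc R M (\<Inter>(g ` \<K>))"
    proof -
      have "(\<Union>K\<in>\<K>. K) = (\<Union>K\<in>\<K>. Spec_fc R M - V_fc R M (g K))"
        by (rule SUP_cong[OF refl]) (rule g(2))
      then have "\<Union>\<K> = (\<Union>K\<in>\<K>. Spec_fc R M - V_fc R M (g K))"
        by (simp only: image_ident)
      also have "\<dots> = Spec_fc R M - V_fc R M (\<Inter>(g ` \<K>))"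
        unfolding V_fc_def by blast
      finally show ?thesis .
    qed
    ultimately show ?thesis by (intro exI conjI)
  qed
qed

lemma openin_Z_fc:
  assumes "duo_module R M"
  shows "openin (Z_fc R M) U \<longleftrightarrow> (\<exists>L. submodule L R M \<and> U = Spec_fc R M - V_fc R M L)"
  by (simp add: Z_fc_def topology_inverse'[OF istopology_Z_fc[OF assms]])

lemma topspace_Z_fc:
  assumes "duo_module R M"
  shows "topspace (Z_fc R M) = Spec_fc R M"
proof
  show "topspace (Z_fc R M) \<subseteq> Spec_fc R M"
    using openin_topspace[of "Z_fc R M"] unfolding openin_Z_fc[OF assms] by blast
  have "K \<notin> V_fc R M {\<zero>\<^bsub>M\<^esub>}" for K
  proof
    assume "K \<in> V_fc R M {\<zero>\<^bsub>M\<^esub>}"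
    then have "submodule K R M" "K \<noteq> {\<zero>\<^bsub>M\<^esub>}" "K \<subseteq> {\<zero>\<^bsub>M\<^esub>}"
      by (simp_all add: V_fc_def Spec_fc_def fully_coprime_def fully_invariant_def)
    then show False using submoduleD(2) by blast
  qed
  then have "Spec_fc R M = Spec_fc R M - V_fc R M {\<zero>\<^bsub>M\<^esub>}" by blast
  with submodule_zero have "openin (Z_fc R M) (Spec_fc R M)"
    unfolding openin_Z_fc[OF assms] by (intro exI conjI)
  then show "Spec_fc R M \<subseteq> topspace (Z_fc R M)" by (rule openin_subset)
qed

lemma closedin_Z_fc:
  assumes "duo_module R M"
  shows "closedin (Z_fc R M) C \<longleftrightarrow> (\<exists>L. submodule L R M \<and> C = V_fc R M L)"
proof -
  have sub: "V_fc R M L \<subseteq> Spec_fc R M" for L by (auto simp: V_fc_def)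
  have "C \<subseteq> Spec_fc R M \<and> Spec_fc R M - C = Spec_fc R M - V_fc R M L \<longleftrightarrow> C = V_fc R M L" for L
    using sub[of L] by blast
  then show ?thesis
    unfolding closedin_def openin_Z_fc[OF assms] topspace_Z_fc[OF assms] by metis
qed

end

end

theory Submission
  imports Defs
begin

text \<open>
  The equivalence rests on the inclusion of the simple submodules in the spectrum, which holds for
  every self-injective duo module. Let \<open>S\<close> be simple with \<open>S \<subseteq> X \<odot> Y\<close> and
  \<open>S \<nsubseteq> X\<close>. Then \<open>X \<inter> S = 0\<close>, so the sum \<open>X + S\<close> is direct, and by self-injectivity its
  projection onto \<open>S\<close> extends to an endomorphism \<open>f\<close> of \<open>M\<close>
  (\<open>disjoint_submodules_separated_by_End\<close>). As \<open>f\<close> annihilates \<open>X\<close>, it maps \<open>X \<odot> Y\<close> into \<open>Y\<close>;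
  as it is the identity on \<open>S\<close>, this says \<open>S \<subseteq> Y\<close> (\<open>simple_submodule_in_Spec_fc\<close>).

  The rest is a comparison of closed points with minimal ones. A closed set \<open>V(L)\<close>
  contains with \<open>K\<close> all points of the spectrum inside \<open>K\<close>, and \<open>V(K)\<close> consists of exactly
  these; so a point is closed iff it is minimal in the spectrum. By atomicity every point contains a
  simple submodule, which is itself a point, so the minimal points are the simple submodules.
  Hence all points are closed iff all points are simple.
\<close>

context left_module
begin

lemma duo_submodule_fully_invariant:
  "duo_module R M \<Longrightarrow> submodule L R M \<Longrightarrow> fully_invariant R M L"
  by (simp add: duo_module_def)

text \<open>The values of the projection are described on sums only, so that no choice of components
  appears in later arguments.\<close>

lemma direct_sum_projection:
  assumes X: "submodule X R M" and Y: "submodule Y R M" and disj: "X \<inter> Y \<subseteq> {\<zero>\<^bsub>M\<^esub>}"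
  obtains p where "\<And>x y. x \<in> X \<Longrightarrow> y \<in> Y \<Longrightarrow> p (x \<oplus>\<^bsub>M\<^esub> y) = y"
proof -
  note Xc = subsetD[OF submoduleD(1)[OF X]] and Yc = subsetD[OF submoduleD(1)[OF Y]]
  have unique: "y = y'"
    if "x \<in> X" "y \<in> Y" "x' \<in> X" "y' \<in> Y" and eq: "x \<oplus>\<^bsub>M\<^esub> y = x' \<oplus>\<^bsub>M\<^esub> y'" for x y x' y'
  proof -
    have c: "x \<in> carrier M" "y \<in> carrier M" "x' \<in> carrier M" "y' \<in> carrier M"
      using that Xc Yc by auto
    \<comment> \<open>The difference \<open>y - y'\<close> equals \<open>x' - x\<close>, so it lies in \<open>X \<inter> Y\<close>.\<close>
    have "y \<oplus>\<^bsub>M\<^esub> \<ominus>\<^bsub>M\<^esub> y' = \<ominus>\<^bsub>M\<^esub> x \<oplus>\<^bsub>M\<^esub> (x \<oplus>\<^bsub>M\<^esub> y) \<oplus>\<^bsub>M\<^esub> \<ominus>\<^bsub>M\<^esub> y'"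
      using c by (simp add: M.r_neg1)
    also have "\<dots> = \<ominus>\<^bsub>M\<^esub> x \<oplus>\<^bsub>M\<^esub> x'"
      unfolding eq using c by (simp add: M.a_assoc M.r_neg)
    finally have "y \<oplus>\<^bsub>M\<^esub> \<ominus>\<^bsub>M\<^esub> y' = \<ominus>\<^bsub>M\<^esub> x \<oplus>\<^bsub>M\<^esub> x'" .
    moreover have "y \<oplus>\<^bsub>M\<^esub> \<ominus>\<^bsub>M\<^esub> y' \<in> Y" "\<ominus>\<^bsub>M\<^esub> x \<oplus>\<^bsub>M\<^esub> x' \<in> X"
      using that submoduleD(3,4)[OF X] submoduleD(3,4)[OF Y] by auto
    ultimately have "y \<oplus>\<^bsub>M\<^esub> \<ominus>\<^bsub>M\<^esub> y' = \<zero>\<^bsub>M\<^esub>"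
      using disj by auto
    then show ?thesis
      using c M.minus_equality[of y "\<ominus>\<^bsub>M\<^esub> y'"] by simp
  qed
  let ?p = "\<lambda>z. THE y. y \<in> Y \<and> (\<exists>x\<in>X. z = x \<oplus>\<^bsub>M\<^esub> y)"
  have "?p (x \<oplus>\<^bsub>M\<^esub> y) = y" if "x \<in> X" "y \<in> Y" for x y
    by (rule the_equality) (use that unique in blast)+
  then show thesis
    by (rule that)
qed

lemma submodule_sum:
  assumes X: "submodule X R M" and Y: "submodule Y R M"
  shows "submodule {x \<oplus>\<^bsub>M\<^esub> y |x y. x \<in> X \<and> y \<in> Y} R M"
proof (rule submodule_intro)
  note Xc = subsetD[OF submoduleD(1)[OF X]] and Yc = subsetD[OF submoduleD(1)[OF Y]]
  let ?N = "{x \<oplus>\<^bsub>M\<^esub> y |x y. x \<in> X \<and> y \<in> Y}"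
  show "?N \<subseteq> carrier M"
    using Xc Yc by auto
  have "\<zero>\<^bsub>M\<^esub> = \<zero>\<^bsub>M\<^esub> \<oplus>\<^bsub>M\<^esub> \<zero>\<^bsub>M\<^esub>"
    by simp
  then show "\<zero>\<^bsub>M\<^esub> \<in> ?N"
    using submoduleD(2)[OF X] submoduleD(2)[OF Y] by blast
  fix z assume "z \<in> ?N"
  then obtain x y where z: "z = x \<oplus>\<^bsub>M\<^esub> y" "x \<in> X" "y \<in> Y" by blast
  have "\<ominus>\<^bsub>M\<^esub> z = \<ominus>\<^bsub>M\<^esub> x \<oplus>\<^bsub>M\<^esub> \<ominus>\<^bsub>M\<^esub> y"
    using z Xc Yc by (simp add: M.minus_add)
  then show "\<ominus>\<^bsub>M\<^esub> z \<in> ?N"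
    using z submoduleD(3)[OF X] submoduleD(3)[OF Y] by blast
  show "a \<odot>\<^bsub>M\<^esub> z \<in> ?N" if a: "a \<in> carrier R" for a
  proof -
    have "a \<odot>\<^bsub>M\<^esub> z = a \<odot>\<^bsub>M\<^esub> x \<oplus>\<^bsub>M\<^esub> a \<odot>\<^bsub>M\<^esub> y"
      using a z Xc Yc by (simp add: smult_r_distr)
    then show ?thesis
      using a z submoduleD(5)[OF X] submoduleD(5)[OF Y] by blast
  qed
  fix z' assume "z' \<in> ?N"
  then obtain x' y' where z': "z' = x' \<oplus>\<^bsub>M\<^esub> y'" "x' \<in> X" "y' \<in> Y" by blast
  have "z \<oplus>\<^bsub>M\<^esub> z' = (x \<oplus>\<^bsub>M\<^esub> x') \<oplus>\<^bsub>M\<^esub> (y \<oplus>\<^bsub>M\<^esub> y')"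
    using z z' Xc Yc by (simp add: M.a_ac)
  then show "z \<oplus>\<^bsub>M\<^esub> z' \<in> ?N"
    using z z' submoduleD(4)[OF X] submoduleD(4)[OF Y] by blast
qed

text \<open>The required endomorphism extends the projection of the direct sum \<open>X + Y\<close> onto
  \<open>Y\<close>; this is where self-injectivity enters.\<close>

lemma disjoint_submodules_separated_by_End:
  assumes inj: "self_injective R M"
    and X: "submodule X R M" and Y: "submodule Y R M" and disj: "X \<inter> Y \<subseteq> {\<zero>\<^bsub>M\<^esub>}"
  obtains f where "f \<in> An R M X" "\<And>y. y \<in> Y \<Longrightarrow> f y = y"
proof -
  note Xc = subsetD[OF submoduleD(1)[OF X]] and Yc = subsetD[OF submoduleD(1)[OF Y]]
  obtain p where p: "\<And>x y. x \<in> X \<Longrightarrow> y \<in> Y \<Longrightarrow> p (x \<oplus>\<^bsub>M\<^esub> y) = y"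
    using direct_sum_projection[OF X Y disj] by blast
  let ?N = "{x \<oplus>\<^bsub>M\<^esub> y |x y. x \<in> X \<and> y \<in> Y}"
  have cl: "p z \<in> carrier M" if "z \<in> ?N" for z
    using that p Yc by auto
  have add: "p (z \<oplus>\<^bsub>M\<^esub> z') = p z \<oplus>\<^bsub>M\<^esub> p z'" if N: "z \<in> ?N" "z' \<in> ?N" for z z'
  proof -
    obtain x y x' y' where z: "z = x \<oplus>\<^bsub>M\<^esub> y" "x \<in> X" "y \<in> Y"
      and z': "z' = x' \<oplus>\<^bsub>M\<^esub> y'" "x' \<in> X" "y' \<in> Y"
      using N by blast
    have "z \<oplus>\<^bsub>M\<^esub> z' = (x \<oplus>\<^bsub>M\<^esub> x') \<oplus>\<^bsub>M\<^esub> (y \<oplus>\<^bsub>M\<^esub> y')"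
      using z z' Xc Yc by (simp add: M.a_ac)
    then show ?thesis
      using z z' p submoduleD(4)[OF X] submoduleD(4)[OF Y] by simp
  qed
  have smult: "p (a \<odot>\<^bsub>M\<^esub> z) = a \<odot>\<^bsub>M\<^esub> p z" if "a \<in> carrier R" "z \<in> ?N" for a z
  proof -
    obtain x y where z: "z = x \<oplus>\<^bsub>M\<^esub> y" "x \<in> X" "y \<in> Y"
      using \<open>z \<in> ?N\<close> by blast
    then show ?thesis
      using that(1) Xc Yc p submoduleD(5)[OF X] submoduleD(5)[OF Y]
      by (simp add: smult_r_distr)
  qed
  have "p \<in> module_hom R (M\<lparr>carrier := ?N\<rparr>) M"
    unfolding module_hom_def hom_def using cl add smult by simp
  then have "\<exists>f \<in> module_End R M. \<forall>z \<in> ?N. f z = p z"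
    by (rule inj[unfolded self_injective_def, rule_format, OF submodule_sum[OF X Y]])
  then obtain f where f: "f \<in> module_End R M" "\<forall>z \<in> ?N. f z = p z"
    by (rule bexE)
  have fp: "f (x \<oplus>\<^bsub>M\<^esub> y) = y" if "x \<in> X" "y \<in> Y" for x y
  proof -
    have "x \<oplus>\<^bsub>M\<^esub> y \<in> ?N"
      using that by blast
    then show ?thesis
      using f(2) p[OF that] by simp
  qed
  show thesis
  proof (rule that)
    have "f x = \<zero>\<^bsub>M\<^esub>" if "x \<in> X" for x
      using fp[OF that submoduleD(2)[OF Y]] Xc[OF that] by simp
    then show "f \<in> An R M X"
      using f(1) by (simp add: An_def)
    show "f y = y" if "y \<in> Y" for y
      using fp[OF submoduleD(2)[OF X] that] Yc[OF that] by simp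
  qed
qed

lemma submodule_Int:
  "submodule X R M \<Longrightarrow> submodule Y R M \<Longrightarrow> submodule (X \<inter> Y) R M"
  using submodule_Inter[of "{X, Y}"] by auto

text \<open>If \<open>S\<close> is not contained in \<open>X\<close>, simplicity makes \<open>X\<close> and \<open>S\<close> independent, and an
  endomorphism that annihilates \<open>X\<close> and fixes \<open>S\<close> pointwise carries \<open>S \<subseteq> X \<odot> Y\<close> into \<open>Y\<close>.\<close>

lemma simple_submodule_in_Spec_fc:
  assumes inj: "self_injective R M" and duo: "duo_module R M"
    and S: "S \<in> simple_submodules R M"
  shows "S \<in> Spec_fc R M"
proof -
  have sub: "submodule S R M" and nz: "S \<noteq> {\<zero>\<^bsub>M\<^esub>}"
    and minimal: "\<And>L. submodule L R M \<Longrightarrow> L \<subseteq> S \<Longrightarrow> L = {\<zero>\<^bsub>M\<^esub>} \<or> L = S"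
    using S by (auto simp: simple_submodules_def)
  have "S \<subseteq> Y"
    if X: "fully_invariant R M X" and XY: "S \<subseteq> coproduct_in R M X Y" and "\<not> S \<subseteq> X" for X Y
  proof -
    have X: "submodule X R M"
      using X by (simp add: fully_invariant_def)
    have "X \<inter> S = {\<zero>\<^bsub>M\<^esub>}"
      using minimal[OF submodule_Int[OF X sub]] \<open>\<not> S \<subseteq> X\<close> by blast
    then obtain f where "f \<in> An R M X" "\<And>s. s \<in> S \<Longrightarrow> f s = s"
      using disjoint_submodules_separated_by_End[OF inj X sub] by blast
    then show ?thesis
      using XY unfolding coproduct_in_def by fastforce
  qed
  then show ?thesis
    using nz duo_submodule_fully_invariant[OF duo sub]
    unfolding Spec_fc_def fully_coprime_def by blast
qed

text \<open>A closed set containing \<open>K\<close> contains every point inside \<open>K\<close>, and the closed set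
  given by \<open>K\<close> itself has no other points: the closure of \<open>K\<close> is the set of points inside \<open>K\<close>.\<close>

lemma closedin_Z_fc_singleton_iff:
  assumes duo: "duo_module R M" and K: "K \<in> Spec_fc R M"
  shows "closedin (Z_fc R M) {K} \<longleftrightarrow> (\<forall>P \<in> Spec_fc R M. P \<subseteq> K \<longrightarrow> P = K)"
proof
  assume "closedin (Z_fc R M) {K}"
  then obtain L where "{K} = V_fc R M L"
    unfolding closedin_Z_fc[OF duo] by blast
  then show "\<forall>P \<in> Spec_fc R M. P \<subseteq> K \<longrightarrow> P = K"
    unfolding V_fc_def by blast
next
  assume "\<forall>P \<in> Spec_fc R M. P \<subseteq> K \<longrightarrow> P = K"
  then have "{K} = V_fc R M K"
    using K unfolding V_fc_def by blast
  moreover have "submodule K R M"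
    using K by (simp add: Spec_fc_def fully_coprime_def fully_invariant_def)
  ultimately show "closedin (Z_fc R M) {K}"
    unfolding closedin_Z_fc[OF duo] by blast
qed

text \<open>Atomicity places a simple submodule, hence a point, inside each point. Conversely, a
  simple submodule contains no other point because points are non-zero submodules.\<close>

lemma minimal_in_Spec_fc_iff_simple:
  assumes "S_IAD_module R M" and K: "K \<in> Spec_fc R M"
  shows "(\<forall>P \<in> Spec_fc R M. P \<subseteq> K \<longrightarrow> P = K) \<longleftrightarrow> K \<in> simple_submodules R M"
proof
  have inj: "self_injective R M" and atomic: "atomic_module R M" and duo: "duo_module R M"
    using assms(1) by (auto simp: S_IAD_module_def)
  have "submodule K R M" "K \<noteq> {\<zero>\<^bsub>M\<^esub>}"
    using K by (auto simp: Spec_fc_def fully_coprime_def fully_invariant_def)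
  then obtain S where S: "S \<in> simple_submodules R M" "S \<subseteq> K"
    using atomic unfolding atomic_module_def by blast
  assume "\<forall>P \<in> Spec_fc R M. P \<subseteq> K \<longrightarrow> P = K"
  then show "K \<in> simple_submodules R M"
    using S simple_submodule_in_Spec_fc[OF inj duo S(1)] by auto
next
  assume "K \<in> simple_submodules R M"
  then show "\<forall>P \<in> Spec_fc R M. P \<subseteq> K \<longrightarrow> P = K"
    by (auto simp: simple_submodules_def Spec_fc_def fully_coprime_def fully_invariant_def)
qed

end

theorem proposition3p40:
  fixes R :: "('a, 'r) ring_scheme" and M :: "('a, 'b, 'm) module_scheme"
  assumes "left_module R M"
    and "\<one>\<^bsub>R\<^esub> \<noteq> \<zero>\<^bsub>R\<^esub>"
    and "carrier M \<noteq> {\<zero>\<^bsub>M\<^esub>}"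
    and "S_IAD_module R M"
  shows "Spec_fc R M = simple_submodules R M \<longleftrightarrow> t1_space (Z_fc R M)"
proof -
  interpret left_module R M by (rule assms(1))
  have inj: "self_injective R M" and duo: "duo_module R M"
    using assms(4) by (auto simp: S_IAD_module_def)
  have "t1_space (Z_fc R M) \<longleftrightarrow> (\<forall>K \<in> Spec_fc R M. closedin (Z_fc R M) {K})"
    by (simp add: t1_space_closedin_singleton topspace_Z_fc[OF duo])
  also have "\<dots> \<longleftrightarrow> (\<forall>K \<in> Spec_fc R M. K \<in> simple_submodules R M)"
  proof (rule ball_cong[OF refl])
    fix K assume K: "K \<in> Spec_fc R M"
    show "closedin (Z_fc R M) {K} \<longleftrightarrow> K \<in> simple_submodules R M"
      unfolding closedin_Z_fc_singleton_iff[OF duo K]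
      by (rule minimal_in_Spec_fc_iff_simple[OF assms(4) K])
  qed
  also have "\<dots> \<longleftrightarrow> Spec_fc R M = simple_submodules R M"
    using simple_submodule_in_Spec_fc[OF inj duo] by blast
  finally show ?thesis by (rule sym)
qed

end
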